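(* Suppose that $f\in\mathcal{B}$ and $f(z)=\sum_{n=0}^{\infty}a_nz^n$. Then $$\sum_{n=0}^{\infty}|a_n|r^n+\left(\frac{1}{1+|a_0|}+\frac{r}{1-r}\right)\sum_{n=1}^{\infty}|a_n|^2r^{2n}+|f(z)-a_0|\le 1\quad\text{for } |z|=r\le\frac15,$$ and the number $1/5$ cannot be improved. Moreover, $$|a_0|^2+\sum_{n=1}^{\infty}|a_n|r^n+\left(\frac{1}{1+|a_0|}+\frac{r}{1-r}\right)\sum_{n=1}^{\infty}|a_n|^2r^{2n}+|f(z)-a_0|\le 1\quad\text{for } |z|=r\le\frac13,$$ and the constant $1/3$ cannot be improved.
   Context: $\mathbb{D}=\{z\in\mathbb{C}:|z|<1\}$ and $\mathcal{B}$ is the set of all analytic functions $f:\mathbb{D}\to\mathbb{D}$. "Cannot be improved" means that the radius cannot be replaced by any larger number so that the corresponding inequality still holds for all $f\in\mathcal{B}$. *)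

theory Defs
  imports "HOL-Complex_Analysis.Complex_Analysis"
begin

definition disc_self_maps :: "(complex \<Rightarrow> complex) set" where
  "disc_self_maps = {f. f analytic_on ball 0 1 \<and> f ` ball 0 1 \<subseteq> ball 0 1}"

definition has_power_series_on_disc :: "(complex \<Rightarrow> complex) \<Rightarrow> (nat \<Rightarrow> complex) \<Rightarrow> bool" where
  "has_power_series_on_disc f a \<longleftrightarrow> (\<forall>z\<in>ball 0 1. (\<lambda>n. a n * z ^ n) sums f z)"

text \<open>
  Sums starting at index 1 are written with the index shifted by \<^const>\<open>Suc\<close>. When \<open>a\<close> is a power
  series of \<open>f\<close> on the disc, all the series below converge for \<open>norm z < 1\<close>, so the default
  value of \<^const>\<open>suminf\<close> on divergent series plays no role.
\<close>

definition refined_term :: "(nat \<Rightarrow> complex) \<Rightarrow> real \<Rightarrow> real" where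
  "refined_term a r =
     (1 / (1 + norm (a 0)) + r / (1 - r)) * (\<Sum>n. (norm (a (Suc n)))\<^sup>2 * r ^ (2 * Suc n))"

definition bohr_sum1 :: "(complex \<Rightarrow> complex) \<Rightarrow> (nat \<Rightarrow> complex) \<Rightarrow> complex \<Rightarrow> real" where
  "bohr_sum1 f a z =
     (\<Sum>n. norm (a n) * norm z ^ n) + refined_term a (norm z) + norm (f z - a 0)"

definition bohr_sum2 :: "(complex \<Rightarrow> complex) \<Rightarrow> (nat \<Rightarrow> complex) \<Rightarrow> complex \<Rightarrow> real" where
  "bohr_sum2 f a z =
     (norm (a 0))\<^sup>2 + (\<Sum>n. norm (a (Suc n)) * norm z ^ Suc n)
       + refined_term a (norm z) + norm (f z - a 0)"

text \<open>
  The inequality \<open>E f a z \<le> 1\<close> holds for every admissible \<open>f\<close> and all \<open>norm z \<le> R\<close>. The points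
  \<open>z\<close> are confined to the disc, outside which \<open>f\<close> is unconstrained, so that the predicate is
  also meaningful for \<open>R \<ge> 1\<close>.
\<close>

definition bohr_inequality_upto ::
    "((complex \<Rightarrow> complex) \<Rightarrow> (nat \<Rightarrow> complex) \<Rightarrow> complex \<Rightarrow> real) \<Rightarrow> real \<Rightarrow> bool" where
  "bohr_inequality_upto E R \<longleftrightarrow>
     (\<forall>f\<in>disc_self_maps. \<forall>a. has_power_series_on_disc f a \<longrightarrow>
        (\<forall>z\<in>ball 0 1. norm z \<le> R \<longrightarrow> E f a z \<le> 1))"

end

(* Write alpha = 1 - |a_0|^2. Carlson's sharpening of |a_n| <= alpha bounds |a_{2n}| and |a_{2n+1}|
   by 1 minus a weighted sum of the lower |a_k|^2. Weighting these bounds by r^n and summing gives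
   sum_{n>=1} |a_n| r^n + (refined term) <= alpha r/(1-r). As |f(z) - a_0| is at most the first sum,
   the quantities of the theorem are at most |a_0| + 2 alpha r/(1-r) and |a_0|^2 + 2 alpha r/(1-r).
   For sharpness, (x - z)/(1 - xz) is evaluated at z = r, with x close to 1.

   The Carlson bounds come from the contractivity of multiplication by f on L^2 of the circle,
   i.e. |<f p, q>| <= (|p|^2 + |q|^2)/2, for explicit polynomials p and q; radii r < 1 come first,
   then r tends to 1. *)
theory Submission
  imports Defs
begin

section \<open>Fourier integrals over one period of the circle\<close>

lemma has_integral_cis_int:
  fixes k :: int
  shows "((\<lambda>t. cis (2 * pi * of_int k * t)) has_integral (if k = 0 then 1 else 0)) {0..1}"
proof (cases "k = 0")
  case True
  have "((\<lambda>t::real. 1::complex) has_integral 1) {0..1}"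
    using has_integral_const_real[of "1::complex" 0 1] by simp
  then show ?thesis using True by simp
next
  case False
  define w where "w = 2 * pi * of_int k"
  have w: "w \<noteq> 0" using False by (simp add: w_def)
  have "((\<lambda>t. cis (w * t)) has_integral (cis (w * 1) / (\<i> * w) - cis (w * 0) / (\<i> * w))) {0..1}"
  proof (rule fundamental_theorem_of_calculus)
    fix t :: real
    have "((\<lambda>t. exp (\<i> * of_real w * of_real t) / (\<i> * w)) has_vector_derivative
            exp (\<i> * of_real w * of_real t)) (at t within {0..1})"
      using w by (auto intro!: derivative_eq_intros has_vector_derivative_real_field)
    then show "((\<lambda>t. cis (w * t) / (\<i> * w)) has_vector_derivative cis (w * t)) (at t within {0..1})"
      by (simp add: cis_conv_exp mult.assoc)
  qed simp
  moreover have "cis w = 1"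
    by (auto simp: w_def cis_conv_exp exp_eq_1)
  ultimately show ?thesis using False by (simp add: w_def)
qed

text \<open>Absolute summability makes the series converge uniformly by the M-test, so it may be
  integrated term by term, and orthogonality of the exponentials leaves at most one term. The value
  is 0 for negative \<open>k\<close> because the series has only nonnegative frequencies.\<close>

lemma has_integral_Fourier_coeff:
  fixes b :: "nat \<Rightarrow> complex" and k :: int
  assumes b: "summable (\<lambda>n. norm (b n))"
  shows "((\<lambda>t. (\<Sum>n. b n * cis (2 * pi * n * t)) * cis (- 2 * pi * of_int k * t))
           has_integral (if k \<ge> 0 then b (nat k) else 0)) {0..1}"
proof -
  let ?F = "\<lambda>K t. \<Sum>n<K. b n * cis (2 * pi * of_int (int n - k) * t)"
  let ?G = "\<lambda>t. \<Sum>n. b n * cis (2 * pi * of_int (int n - k) * t)"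
  have lim: "uniform_limit {0..1} ?F ?G sequentially"
    by (rule Weierstrass_m_test[OF _ b]) (simp add: norm_mult)
  have cont: "continuous_on {0..1} (?F K)" for K
    by (intro continuous_intros)
  obtain I J where I: "\<And>K. (?F K has_integral I K) {0..1}" and J: "(?G has_integral J) {0..1}"
    and IJ: "I \<longlonglongrightarrow> J"
    using uniform_limit_integral[OF lim cont] by auto
  have "(?F K has_integral (\<Sum>n<K. b n * (if int n - k = 0 then 1 else 0))) {0..1}" for K
    by (intro has_integral_sum has_integral_mult_right has_integral_cis_int) auto
  then have I': "I K = (\<Sum>n<K. b n * (if int n - k = 0 then 1 else 0))" for K
    using I has_integral_unique by blast
  \<comment> \<open>The integrals of the partial sums are constant as soon as the frequency
    \<open>k\<close> is included, so their limit is that constant.\<close>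
  have "I K = (if k \<ge> 0 then b (nat k) else 0)" if "K > nat k" for K
  proof -
    have "I K = (\<Sum>n<K. if n = nat k then (if k \<ge> 0 then b (nat k) else 0) else 0)"
      unfolding I' by (intro sum.cong) auto
    then show ?thesis using that by simp
  qed
  then have "eventually (\<lambda>K. I K = (if k \<ge> 0 then b (nat k) else 0)) sequentially"
    by (rule eventually_mono[OF eventually_gt_at_top])
  then have "I \<longlonglongrightarrow> (if k \<ge> 0 then b (nat k) else 0)"
    by (rule tendsto_eventually)
  then have J': "J = (if k \<ge> 0 then b (nat k) else 0)"
    using IJ LIMSEQ_unique by blast
  have sm: "summable (\<lambda>n. b n * cis (2 * pi * n * t))" for t :: real
    by (rule summable_norm_cancel) (simp add: norm_mult b)
  have "?G t = (\<Sum>n. b n * cis (2 * pi * n * t)) * cis (- 2 * pi * of_int k * t)" for t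
    by (subst suminf_mult2[OF sm]) (simp add: mult.assoc cis_mult algebra_simps)
  then show ?thesis using J J' by simp
qed

text \<open>Parseval for trigonometric polynomials: expand the square into a double sum and keep its
  diagonal.\<close>

lemma has_integral_norm_trig_poly_sq:
  fixes c :: "nat \<Rightarrow> complex"
  shows "((\<lambda>t. (norm (\<Sum>j\<le>N. c j * cis (2 * pi * j * t)))\<^sup>2) has_integral (\<Sum>j\<le>N. (norm (c j))\<^sup>2)) {0..1}"
proof -
  let ?x = "\<lambda>t. \<Sum>j\<le>N. c j * cis (2 * pi * j * t)"
  have "((\<lambda>t. \<Sum>j\<le>N. \<Sum>m\<le>N. c j * cnj (c m) * cis (2 * pi * of_int (int j - int m) * t)) has_integral
          (\<Sum>j\<le>N. \<Sum>m\<le>N. c j * cnj (c m) * (if int j - int m = 0 then 1 else 0))) {0..1}"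
    by (intro has_integral_sum has_integral_mult_right has_integral_cis_int) auto
  moreover have "(\<Sum>j\<le>N. \<Sum>m\<le>N. c j * cnj (c m) * (if int j - int m = 0 then 1 else 0))
      = of_real (\<Sum>j\<le>N. (norm (c j))\<^sup>2)"
  proof -
    have "(\<Sum>m\<le>N. c j * cnj (c m) * (if int j - int m = 0 then 1 else 0)) = of_real ((norm (c j))\<^sup>2)"
      if "j \<le> N" for j
    proof -
      have "(\<Sum>m\<le>N. c j * cnj (c m) * (if int j - int m = 0 then 1 else 0))
          = (\<Sum>m\<le>N. if m = j then c j * cnj (c j) else 0)"
        by (intro sum.cong) auto
      then show ?thesis using that by (simp add: complex_norm_square[symmetric])
    qed
    then show ?thesis by simp
  qed
  moreover have "(\<Sum>j\<le>N. \<Sum>m\<le>N. c j * cnj (c m) * cis (2 * pi * of_int (int j - int m) * t))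
      = of_real ((norm (?x t))\<^sup>2)" for t
    by (simp only: complex_norm_square cnj_sum sum_product)
       (intro sum.cong refl, simp add: cis_cnj cis_mult algebra_simps)
  ultimately have "((\<lambda>t. complex_of_real ((norm (?x t))\<^sup>2)) has_integral
      of_real (\<Sum>j\<le>N. (norm (c j))\<^sup>2)) {0..1}" by simp
  then have "((\<lambda>t. Re (complex_of_real ((norm (?x t))\<^sup>2))) has_integral
      Re (of_real (\<Sum>j\<le>N. (norm (c j))\<^sup>2))) {0..1}"
    by (rule has_integral_Re)
  then show ?thesis by (simp only: Re_complex_of_real)
qed

section \<open>Contractivity of multiplication by a bounded analytic function\<close>

text \<open>The form is the integral of \<open>F t * x t * cnj (y t)\<close>, where \<open>F\<close>
  is the boundary function and \<open>x\<close>, \<open>y\<close> are the trigonometric polynomials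
  with coefficients \<open>c\<close>, \<open>d\<close>. Since \<open>F\<close> has modulus at most
  1, the integrand is at most half of the sum of the squared moduli of \<open>x\<close> and
  \<open>y\<close>, which Parseval integrates.\<close>

lemma Toeplitz_form_bound:
  fixes b c d :: "nat \<Rightarrow> complex"
  assumes b: "summable (\<lambda>n. norm (b n))"
    and bound: "\<And>t. norm (\<Sum>n. b n * cis (2 * pi * n * t)) \<le> 1"
  shows "norm (\<Sum>m\<le>N. cnj (d m) * (\<Sum>j\<le>m. b (m - j) * c j))
           \<le> ((\<Sum>j\<le>N. (norm (c j))\<^sup>2) + (\<Sum>j\<le>N. (norm (d j))\<^sup>2)) / 2"
proof -
  define F where "F t = (\<Sum>n. b n * cis (2 * pi * real n * t))" for t
  define x where "x t = (\<Sum>j\<le>N. c j * cis (2 * pi * real j * t))" for t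
  define y where "y t = (\<Sum>j\<le>N. d j * cis (2 * pi * real j * t))" for t
  have "((\<lambda>t. \<Sum>m\<le>N. \<Sum>j\<le>N. cnj (d m) * c j * (F t * cis (- 2 * pi * of_int (int m - int j) * t)))
     has_integral (\<Sum>m\<le>N. \<Sum>j\<le>N. cnj (d m) * c j *
        (if int m - int j \<ge> 0 then b (nat (int m - int j)) else 0))) {0..1}"
    unfolding F_def
    by (intro has_integral_sum has_integral_mult_right has_integral_Fourier_coeff[OF b]) auto
  moreover have "(\<Sum>m\<le>N. \<Sum>j\<le>N. cnj (d m) * c j * (F t * cis (- 2 * pi * of_int (int m - int j) * t)))
      = F t * x t * cnj (y t)" for t
  proof -
    have "F t * x t * cnj (y t) = F t * (cnj (y t) * x t)" by simp
    also have "\<dots> = (\<Sum>m\<le>N. \<Sum>j\<le>N. F t * (cnj (d m * cis (2 * pi * real m * t)) * (c j * cis (2 * pi * real j * t))))"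
      by (simp only: x_def y_def cnj_sum sum_product) (simp only: sum_distrib_left)
    also have "\<dots> = (\<Sum>m\<le>N. \<Sum>j\<le>N. cnj (d m) * c j * (F t * cis (- 2 * pi * of_int (int m - int j) * t)))"
      by (intro sum.cong refl) (simp add: cis_cnj cis_mult algebra_simps)
    finally show ?thesis by simp
  qed
  \<comment> \<open>For \<open>j > m\<close> the frequency \<open>m - j\<close> is negative and its
    Fourier coefficient vanishes, so the inner sum stops at \<open>m\<close>. The difference is
    taken in \<open>int\<close> to avoid truncated subtraction.\<close>
  moreover have "(\<Sum>m\<le>N. \<Sum>j\<le>N. cnj (d m) * c j * (if int m - int j \<ge> 0 then b (nat (int m - int j)) else 0))
     = (\<Sum>m\<le>N. cnj (d m) * (\<Sum>j\<le>m. b (m - j) * c j))"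
  proof (intro sum.cong refl)
    fix m assume "m \<in> {..N}"
    then have "(\<Sum>j\<le>N. cnj (d m) * c j * (if int m - int j \<ge> 0 then b (nat (int m - int j)) else 0))
      = (\<Sum>j\<le>m. cnj (d m) * c j * (if int m - int j \<ge> 0 then b (nat (int m - int j)) else 0))"
      by (intro sum.mono_neutral_right) auto
    also have "\<dots> = (\<Sum>j\<le>m. cnj (d m) * (b (m - j) * c j))"
      by (intro sum.cong refl) (auto simp: nat_diff_distrib)
    finally show "(\<Sum>j\<le>N. cnj (d m) * c j * (if int m - int j \<ge> 0 then b (nat (int m - int j)) else 0))
      = cnj (d m) * (\<Sum>j\<le>m. b (m - j) * c j)" by (simp add: sum_distrib_left)
  qed
  ultimately have I: "((\<lambda>t. F t * x t * cnj (y t)) has_integral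
      (\<Sum>m\<le>N. cnj (d m) * (\<Sum>j\<le>m. b (m - j) * c j))) {0..1}" by simp
  have J: "((\<lambda>t. ((norm (x t))\<^sup>2 + (norm (y t))\<^sup>2) / 2) has_integral
      ((\<Sum>j\<le>N. (norm (c j))\<^sup>2) + (\<Sum>j\<le>N. (norm (d j))\<^sup>2)) / 2) {0..1}"
    unfolding x_def y_def
    by (intro has_integral_divide has_integral_add has_integral_norm_trig_poly_sq)
  have "norm (F t * x t * cnj (y t)) \<le> ((norm (x t))\<^sup>2 + (norm (y t))\<^sup>2) / 2" for t
  proof -
    have "norm (F t) * (norm (x t) * norm (y t)) \<le> 1 * (norm (x t) * norm (y t))"
      by (intro mult_right_mono) (use bound in \<open>auto simp: F_def\<close>)
    moreover have "2 * (norm (x t) * norm (y t)) \<le> (norm (x t))\<^sup>2 + (norm (y t))\<^sup>2"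
      using sum_squares_bound[of "norm (x t)" "norm (y t)"] by (simp add: mult.assoc)
    ultimately show ?thesis by (simp add: norm_mult mult.assoc)
  qed
  then have "norm (integral {0..1} (\<lambda>t. F t * x t * cnj (y t)))
      \<le> integral {0..1} (\<lambda>t. ((norm (x t))\<^sup>2 + (norm (y t))\<^sup>2) / 2)"
    using I J by (intro integral_norm_bound_integral) (auto simp: has_integral_integrable)
  then show ?thesis
    using integral_unique[OF I] integral_unique[OF J] by simp
qed

section \<open>Carlson's coefficient bounds\<close>

lemma sum_split_at_middle_and_end:
  fixes g :: "nat \<Rightarrow> 'a::comm_monoid_add"
  assumes "n \<ge> 1"
  shows "sum g {..2 * n} = sum g {..<n} + g n + sum g {n<..<2 * n} + g (2 * n)"
proof -
  have "{..2 * n} = insert n (insert (2 * n) ({..<n} \<union> {n<..<2 * n}))" using assms by auto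
  moreover have "sum g ({..<n} \<union> {n<..<2 * n}) = sum g {..<n} + sum g {n<..<2 * n}"
    by (rule sum.union_disjoint) auto
  ultimately show ?thesis using assms by (simp add: ac_simps)
qed

lemma sum_split_at_start_and_middle:
  fixes g :: "nat \<Rightarrow> 'a::comm_monoid_add"
  assumes "n \<ge> 1"
  shows "sum g {..2 * n} = g 0 + sum g {0<..<n} + g n + sum g {n<..2 * n}"
proof -
  have "{..2 * n} = insert 0 (insert n ({0<..<n} \<union> {n<..2 * n}))" using assms by auto
  moreover have "sum g ({0<..<n} \<union> {n<..2 * n}) = sum g {0<..<n} + sum g {n<..2 * n}"
    by (rule sum.union_disjoint) auto
  ultimately show ?thesis using assms by (simp add: ac_simps)
qed

lemma sum_split_at_ends:
  fixes g :: "nat \<Rightarrow> 'a::comm_monoid_add"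
  assumes "n \<ge> 1"
  shows "sum g {..n} = g 0 + sum g {0<..<n} + g n"
proof -
  have "{..n} = insert 0 (insert n {0<..<n})" using assms by auto
  then show ?thesis using assms by (simp add: ac_simps)
qed

lemma sum_upper_half_reversed: "(\<Sum>j\<in>{n<..2 * n}. g (2 * n - j)) = (\<Sum>k<n. g k)" for n :: nat
  by (rule sum.reindex_bij_witness[of _ "\<lambda>k. 2 * n - k" "\<lambda>k. 2 * n - k"]) auto

lemma coeff_even_bound_circle:
  fixes b :: "nat \<Rightarrow> complex"
  assumes b: "summable (\<lambda>n. norm (b n))"
    and bound: "\<And>t. norm (\<Sum>n. b n * cis (2 * pi * n * t)) \<le> 1"
    and n: "n \<ge> 1"
  shows "norm (b (2 * n)) + (\<Sum>k<n. (norm (b k))\<^sup>2) + (norm (b n))\<^sup>2 / (1 + norm (b 0)) \<le> 1"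
proof -
  define S where "S = (\<Sum>k<n. (norm (b k))\<^sup>2)"
  define t where "t = 1 / (1 + norm (b 0))"
  \<comment> \<open>Since \<open>sgn 0 = 0\<close>, the zero case is set to 1 so that
    \<open>\<epsilon>\<close> always has modulus 1.\<close>
  define \<epsilon> where "\<epsilon> = (if b (2 * n) = 0 then 1 else sgn (b (2 * n)))"
  \<comment> \<open>\<open>c\<close> and \<open>d\<close> make every \<open>(norm (b k))\<^sup>2\<close>, \<open>k < n\<close>, occur twice in the form but only once in the
    bound; the unimodular \<open>\<epsilon>\<close> aligns \<open>b (2 * n)\<close>, and \<open>t\<close> optimises the middle coefficient.\<close>
  define c where "c j = (if j = 0 then 1 else if j < n then 0 else if j = n then \<epsilon> * t * cnj (b n)
      else \<epsilon> * cnj (b (2 * n - j)))" for j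
  define d where "d m = (if m < n then b m else if m = n then t * b n else if m = 2 * n then \<epsilon> else 0)" for m
  define A where "A = (norm (b n))\<^sup>2"
  have t: "t > 0" "t * (1 + norm (b 0)) = 1"
    by (simp_all add: t_def add_pos_nonneg add_nonneg_eq_0_iff)
  have \<epsilon>: "norm \<epsilon> = 1" by (simp add: \<epsilon>_def norm_sgn)
  then have \<epsilon>\<epsilon>: "cnj \<epsilon> * \<epsilon> = 1"
    using complex_norm_square[of \<epsilon>] by (simp add: mult.commute)
  have \<epsilon>b: "cnj \<epsilon> * b (2 * n) = norm (b (2 * n))"
  proof (cases "b (2 * n) = 0")
    case False
    then have "b (2 * n) = norm (b (2 * n)) * \<epsilon>"
      by (simp add: \<epsilon>_def sgn_eq)
    then have "cnj \<epsilon> * b (2 * n) = norm (b (2 * n)) * (cnj \<epsilon> * \<epsilon>)" by (metis mult.left_commute)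
    then show ?thesis by (simp add: \<epsilon>\<epsilon>)
  qed simp
  note sum_split = sum_split_at_middle_and_end[OF n]
  note sum_split' = sum_split_at_start_and_middle[OF n]
  note sum_splitn = sum_split_at_ends[OF n]
  have Sc: "(\<Sum>k<n. cnj (b k) * b k) = S"
    unfolding S_def of_real_sum by (simp only: complex_norm_square mult.commute)
  have Ac: "b n * cnj (b n) = A" unfolding A_def by (rule complex_norm_square[symmetric])
  have c: "c 0 = 1" "\<And>j. j \<in> {0<..<n} \<Longrightarrow> c j = 0" "c n = \<epsilon> * t * cnj (b n)"
    "\<And>j. j \<in> {n<..2 * n} \<Longrightarrow> c j = \<epsilon> * cnj (b (2 * n - j))"
    using n by (auto simp: c_def)
  have d: "\<And>j. j \<in> {..<n} \<Longrightarrow> d j = b j" "d n = t * b n"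
    "\<And>j. j \<in> {n<..<2 * n} \<Longrightarrow> d j = 0" "d (2 * n) = \<epsilon>"
    using n by (auto simp: d_def)
  have cmid: "(\<Sum>j\<in>{0<..<n}. (norm (c j))\<^sup>2) = 0" "(\<Sum>j\<in>{0<..<n}. g j * c j) = 0" for g
    by (intro sum.neutral ballI; simp add: c)+
  have dmid: "(\<Sum>j\<in>{n<..<2 * n}. (norm (d j))\<^sup>2) = 0" "(\<Sum>j\<in>{n<..<2 * n}. cnj (d j) * g j) = 0" for g
    by (intro sum.neutral ballI; simp add: d)+
  have nc: "(\<Sum>j\<le>2 * n. (norm (c j))\<^sup>2) = 1 + t\<^sup>2 * A + S"
  proof -
    have "(\<Sum>j\<in>{n<..2 * n}. (norm (c j))\<^sup>2) = (\<Sum>j\<in>{n<..2 * n}. (norm (b (2 * n - j)))\<^sup>2)"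
      by (intro sum.cong refl) (simp add: c norm_mult \<epsilon>)
    also have "\<dots> = S" unfolding S_def by (rule sum_upper_half_reversed)
    finally show ?thesis
      unfolding sum_split' cmid by (simp add: c norm_mult \<epsilon> A_def power_mult_distrib)
  qed
  have nd: "(\<Sum>j\<le>2 * n. (norm (d j))\<^sup>2) = S + t\<^sup>2 * A + 1"
  proof -
    have "(\<Sum>j<n. (norm (d j))\<^sup>2) = S"
      unfolding S_def by (intro sum.cong refl) (simp add: d)
    then show ?thesis
      unfolding sum_split dmid by (simp add: d norm_mult \<epsilon> A_def power_mult_distrib)
  qed
  \<comment> \<open>\<open>V\<close> is the convolution of \<open>b\<close> and \<open>c\<close>. It
    is evaluated only for \<open>m < n\<close>, \<open>m = n\<close> and \<open>m = 2 * n\<close>,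
    as \<open>d\<close> vanishes at the other indices up to \<open>2 * n\<close>.\<close>
  define V where "V m = (\<Sum>j\<le>m. b (m - j) * c j)" for m
  have V1: "V m = b m" if "m < n" for m
  proof -
    have "V m = (\<Sum>j\<le>m. if j = 0 then b m else 0)"
      unfolding V_def using that by (intro sum.cong refl) (auto simp: c)
    then show ?thesis by simp
  qed
  have V2: "V n = b n + b 0 * (\<epsilon> * t * cnj (b n))"
    unfolding V_def sum_splitn cmid by (simp add: c)
  have V3: "V (2 * n) = b (2 * n) + \<epsilon> * t * A + \<epsilon> * S"
  proof -
    have "(\<Sum>j\<in>{n<..2 * n}. b (2 * n - j) * c j) = (\<Sum>j\<in>{n<..2 * n}. \<epsilon> * (cnj (b (2 * n - j)) * b (2 * n - j)))"
      by (intro sum.cong refl) (simp add: c)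
    also have "\<dots> = \<epsilon> * S"
      unfolding sum_distrib_left[symmetric] using sum_upper_half_reversed[where g = "\<lambda>k. cnj (b k) * b k"] Sc by simp
    finally show ?thesis
      unfolding V_def sum_split' cmid Ac[symmetric] by (simp add: c mult_2 algebra_simps)
  qed
  have "(\<Sum>m\<le>2 * n. cnj (d m) * V m) = S + cnj (t * b n) * V n + cnj \<epsilon> * V (2 * n)"
  proof -
    have "(\<Sum>m<n. cnj (d m) * V m) = S"
      unfolding Sc[symmetric] by (intro sum.cong refl) (simp add: d V1)
    then show ?thesis
      unfolding sum_split dmid by (simp add: d)
  qed
  also have "cnj \<epsilon> * V (2 * n) = norm (b (2 * n)) + t * A + S"
  proof -
    have "cnj \<epsilon> * V (2 * n) = cnj \<epsilon> * b (2 * n) + (cnj \<epsilon> * \<epsilon>) * (t * A + S)"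
      unfolding V3 by (simp add: algebra_simps)
    then show ?thesis by (simp only: \<epsilon>\<epsilon> \<epsilon>b) simp
  qed
  also have "cnj (t * b n) * V n = t * A + t\<^sup>2 * \<epsilon> * b 0 * (cnj (b n))\<^sup>2"
    unfolding V2 by (simp add: Ac[symmetric] algebra_simps power2_eq_square)
  \<comment> \<open>Everything is real and nonnegative except the last term, the cross term of the
    middle entries of \<open>c\<close> and \<open>d\<close> through \<open>b 0\<close>. Its phase is
    unknown, so it is subtracted in modulus.\<close>
  finally have eq: "(\<Sum>m\<le>2 * n. cnj (d m) * V m) =
      of_real (2 * S + 2 * t * A + norm (b (2 * n))) + t\<^sup>2 * \<epsilon> * b 0 * (cnj (b n))\<^sup>2" by simp
  have "\<bar>2 * S + 2 * t * A + norm (b (2 * n))\<bar> - norm (t\<^sup>2 * \<epsilon> * b 0 * (cnj (b n))\<^sup>2)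
      \<le> norm (\<Sum>m\<le>2 * n. cnj (d m) * V m)"
    unfolding eq using norm_diff_ineq[of "complex_of_real (2 * S + 2 * t * A + norm (b (2 * n)))"]
    by (metis norm_of_real)
  moreover have "norm (t\<^sup>2 * \<epsilon> * b 0 * (cnj (b n))\<^sup>2) = t\<^sup>2 * norm (b 0) * A"
    using t by (simp add: norm_mult norm_power \<epsilon> A_def)
  moreover have "norm (\<Sum>m\<le>2 * n. cnj (d m) * V m) \<le> 1 + t\<^sup>2 * A + S"
    using Toeplitz_form_bound[OF b bound, where N = "2 * n" and c = c and d = d] unfolding nc nd V_def by (simp add: field_simps)
  \<comment> \<open>This is what remains of \<open>A\<close> after the cross term and the bound
    \<open>1 + t^2 * A + S\<close> are moved across. The choice
    \<open>t = 1 / (1 + norm (b 0))\<close> maximises \<open>2 * t - t^2 * (1 + norm (b 0))\<close>,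
    with maximum \<open>t\<close>.\<close>
  moreover have "2 * t * A - t\<^sup>2 * norm (b 0) * A - t\<^sup>2 * A = t * A"
  proof -
    have "2 * t * A - t\<^sup>2 * norm (b 0) * A - t\<^sup>2 * A = 2 * t * A - t * A * (t * (1 + norm (b 0)))"
      by (simp add: algebra_simps power2_eq_square)
    then show ?thesis by (simp only: t)
  qed
  ultimately have "norm (b (2 * n)) + S + t * A \<le> 1" by linarith
  then show ?thesis by (simp add: S_def A_def t_def)
qed

lemma summable_norm_coeffs:
  assumes ser: "has_power_series_on_disc f a" and r: "0 \<le> r" "r < 1"
  shows "summable (\<lambda>n. norm (a n) * r ^ n)"
proof -
  \<comment> \<open>Convergence at a point strictly between \<open>r\<close> and 1 forces absolute
    convergence at \<open>r\<close>.\<close>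
  define s where "s = (1 + r) / 2"
  have s: "r < s" "s < 1" using r by (auto simp: s_def)
  have "(\<lambda>n. a n * of_real s ^ n) sums f (of_real s)"
    using ser r s by (simp add: has_power_series_on_disc_def)
  then have "summable (\<lambda>n. norm (a n * of_real r ^ n))"
    using r s by (intro powser_insidea[of a "of_real s"]) (auto intro: sums_summable)
  then show ?thesis
    using r by (simp add: norm_mult norm_power)
qed

text \<open>For \<open>r < 1\<close> the dilated coefficients \<open>a n * r ^ n\<close> are
  absolutely summable, and their Fourier series is \<open>f\<close> on the circle of radius
  \<open>r\<close>, hence bounded by 1. The circle version therefore applies to them.\<close>

lemma coeff_even_bound:
  assumes ser: "has_power_series_on_disc f a" and f: "f ` ball 0 1 \<subseteq> ball 0 1" and n: "n \<ge> 1"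
  shows "norm (a (2 * n)) + (\<Sum>k<n. (norm (a k))\<^sup>2) + (norm (a n))\<^sup>2 / (1 + norm (a 0)) \<le> 1"
proof -
  let ?L = "\<lambda>r. norm (a (2 * n)) * r ^ (2 * n) + (\<Sum>k<n. (norm (a k) * r ^ k)\<^sup>2)
      + (norm (a n) * r ^ n)\<^sup>2 / (1 + norm (a 0))"
  have le: "?L r \<le> 1" if r: "0 < r" "r < 1" for r :: real
  proof -
    let ?b = "\<lambda>n. a n * of_real r ^ n"
    have "summable (\<lambda>n. norm (?b n))"
      using summable_norm_coeffs[OF ser, of r] r by (simp add: norm_mult norm_power)
    moreover have "norm (\<Sum>n. ?b n * cis (2 * pi * n * t)) \<le> 1" for t
    proof -
      let ?z = "of_real r * cis (2 * pi * t)"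
      have z: "?z \<in> ball 0 1" using r by (simp add: norm_mult)
      then have "(\<lambda>n. a n * ?z ^ n) sums f ?z" using ser by (simp add: has_power_series_on_disc_def)
      moreover have "a n * ?z ^ n = ?b n * cis (2 * pi * n * t)" for n
        by (simp add: power_mult_distrib Complex.DeMoivre mult.assoc) (simp add: mult_ac)
      ultimately have "(\<Sum>n. ?b n * cis (2 * pi * n * t)) = f ?z"
        by (simp add: sums_iff)
      moreover have "f ?z \<in> ball 0 1" using f z by blast
      ultimately show ?thesis by (simp add: less_imp_le)
    qed
    ultimately show ?thesis
      using coeff_even_bound_circle[of ?b n] n r by (simp add: norm_mult norm_power)
  qed
  \<comment> \<open>Only finitely many coefficients occur, so the left side is continuous in
    \<open>r\<close> and the bound passes to \<open>r = 1\<close>.\<close>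
  have "(?L \<longlongrightarrow> ?L 1) (at_left 1)"
    by (intro tendsto_intros) (simp add: add_nonneg_eq_0_iff)
  moreover have "eventually (\<lambda>r. ?L r \<le> 1) (at_left 1)"
    using le by (auto simp: eventually_at_left_field intro!: exI[of _ 0])
  ultimately have "?L 1 \<le> 1"
    by (rule tendsto_upperbound) simp
  then show ?thesis by simp
qed

lemma coeff_odd_bound:
  assumes ser: "has_power_series_on_disc f a" and f: "f ` ball 0 1 \<subseteq> ball 0 1"
  shows "norm (a (2 * n + 1)) + (\<Sum>k\<le>n. (norm (a k))\<^sup>2) \<le> 1"
proof -
  \<comment> \<open>The function \<open>z f(z)\<close> shifts the odd coefficients to even places and has constant term \<open>0\<close>.\<close>
  define b where "b k = (case k of 0 \<Rightarrow> 0 | Suc k \<Rightarrow> a k)" for k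
  have "(\<lambda>n. b n * z ^ n) sums (z * f z)" if "z \<in> ball 0 1" for z
  proof -
    have "(\<lambda>n. a n * z ^ n) sums f z" using ser that by (simp add: has_power_series_on_disc_def)
    then have "(\<lambda>n. z * (a n * z ^ n)) sums (z * f z)" by (rule sums_mult)
    then have "(\<lambda>n. b (Suc n) * z ^ Suc n) sums (z * f z)" by (simp add: b_def mult_ac)
    then show ?thesis by (subst (asm) sums_Suc_iff) (simp add: b_def)
  qed
  then have 1: "has_power_series_on_disc (\<lambda>z. z * f z) b"
    by (simp add: has_power_series_on_disc_def)
  have 2: "(\<lambda>z. z * f z) ` ball 0 1 \<subseteq> ball 0 1"
  proof clarify
    fix z :: complex assume z: "z \<in> ball 0 1"
    then have "f z \<in> ball 0 1" using f by blast
    then have "norm z * norm (f z) < 1 * 1" using z by (intro mult_strict_mono') auto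
    then show "z * f z \<in> ball 0 1" by (simp add: norm_mult)
  qed
  \<comment> \<open>Here \<open>b (2 * Suc n)\<close> is \<open>a (2 * n + 1)\<close>. As
    \<open>b 0 = 0\<close>, the denominator is 1, and the middle term, the square of
    \<open>norm (a n)\<close>, completes the sum to \<open>k \<le> n\<close>.\<close>
  have "norm (b (2 * Suc n)) + (\<Sum>k<Suc n. (norm (b k))\<^sup>2) + (norm (b (Suc n)))\<^sup>2 / (1 + norm (b 0)) \<le> 1"
    using 1 2 by (rule coeff_even_bound) simp
  then show ?thesis
    by (simp add: b_def sum.lessThan_Suc_shift del: sum.lessThan_Suc)
       (simp add: lessThan_Suc_atMost[symmetric])
qed

section \<open>Weighted summation of the coefficient bounds\<close>

text \<open>In the bounds weighted by \<open>r ^ n\<close>, the square of \<open>A k\<close> with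
  \<open>k \<ge> 1\<close> is subtracted with factor \<open>1 / (1 + A 0)\<close> at
  \<open>n = 2 * k\<close> and with factor 1 at every \<open>n > 2 * k\<close>. In total this is
  \<open>(1 / (1 + A 0) + r / (1 - r)) * r ^ (2 * k)\<close>, exactly the weight in the refined
  term. The last summand on the right is the geometric tail \<open>n > 2 * K\<close> that the
  partial sum has not yet used.\<close>

lemma refined_majorant_partial_sum:
  fixes A :: "nat \<Rightarrow> real"
  assumes odd: "\<And>n. A (2 * n + 1) + (\<Sum>k\<le>n. (A k)\<^sup>2) \<le> 1"
    and even: "\<And>n. n \<ge> 1 \<Longrightarrow> A (2 * n) + (\<Sum>k<n. (A k)\<^sup>2) + (A n)\<^sup>2 / (1 + A 0) \<le> 1"
    and r: "0 \<le> r" "r < 1"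
  shows "(\<Sum>n<2 * K. A (Suc n) * r ^ Suc n) + (1 / (1 + A 0) + r / (1 - r)) * (\<Sum>k<K. (A (Suc k))\<^sup>2 * r ^ (2 * Suc k))
    \<le> (1 - (A 0)\<^sup>2) * (\<Sum>n<2 * K. r ^ Suc n) + (\<Sum>k<K. (A (Suc k))\<^sup>2) * r ^ (2 * K + 1) / (1 - r)"
proof (induction K)
  case 0
  then show ?case by simp
next
  case (Suc K)
  define \<alpha> where "\<alpha> = 1 - (A 0)\<^sup>2"
  define Q where "Q = (\<Sum>k<K. (A (Suc k))\<^sup>2)"
  define q where "q = (A (Suc K))\<^sup>2"
  define w where "w = r ^ (2 * K + 1)"
  define c where "c = 1 / (1 + A 0)"
  have w: "w \<ge> 0" using r by (simp add: w_def)
  have "A (2 * K + 1) \<le> \<alpha> - Q"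
    using odd[of K] by (simp add: \<alpha>_def Q_def sum.lessThan_Suc_shift flip: lessThan_Suc_atMost del: sum.lessThan_Suc)
  then have 1: "A (2 * K + 1) * w \<le> (\<alpha> - Q) * w" using w by (rule mult_right_mono)
  have "A (2 * K + 2) \<le> \<alpha> - Q - q * c"
    using even[of "Suc K"]
    by (simp add: \<alpha>_def Q_def q_def c_def sum.lessThan_Suc_shift del: sum.lessThan_Suc)
  then have 2: "A (2 * K + 2) * (w * r) \<le> (\<alpha> - Q - q * c) * (w * r)"
    using w r by (intro mult_right_mono) auto
  \<comment> \<open>Exact balance of the induction step: the old tail, the two new bounds and the
    new refined summand add up to the new geometric terms and the new tail.\<close>
  have 3: "Q * w / (1 - r) + (\<alpha> - Q) * w + (\<alpha> - Q - q * c) * (w * r) + (c + r / (1 - r)) * (q * (w * r))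
     = \<alpha> * (w + w * r) + (Q + q) * (w * r * r) / (1 - r)"
    using r by (simp add: divide_simps) (simp add: algebra_simps)
  have IH: "(\<Sum>n<2 * K. A (Suc n) * r ^ Suc n) + (c + r / (1 - r)) * (\<Sum>k<K. (A (Suc k))\<^sup>2 * r ^ (2 * Suc k))
    \<le> \<alpha> * (\<Sum>n<2 * K. r ^ Suc n) + Q * w / (1 - r)"
    using Suc.IH unfolding \<alpha>_def Q_def w_def c_def .
  have e1: "(\<Sum>n<2 * Suc K. A (Suc n) * r ^ Suc n) =
      (\<Sum>n<2 * K. A (Suc n) * r ^ Suc n) + A (2 * K + 1) * w + A (2 * K + 2) * (w * r)"
    by (simp add: w_def)
  have e2: "(\<Sum>k<Suc K. (A (Suc k))\<^sup>2 * r ^ (2 * Suc k)) =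
     (\<Sum>k<K. (A (Suc k))\<^sup>2 * r ^ (2 * Suc k)) + q * (w * r)"
    by (simp add: q_def w_def)
  have e3: "(\<Sum>n<2 * Suc K. r ^ Suc n) = (\<Sum>n<2 * K. r ^ Suc n) + (w + w * r)"
    by (simp add: w_def)
  have e4: "(\<Sum>k<Suc K. (A (Suc k))\<^sup>2) * r ^ (2 * Suc K + 1) = (Q + q) * (w * r * r)"
    by (simp add: Q_def q_def w_def)
  show ?case
    unfolding e1 e2 e3 e4 c_def[symmetric] \<alpha>_def[symmetric]
    using 1 2 3 IH by argo
qed

text \<open>This is the limit of the partial sum inequality. The squares
  \<open>(A (Suc k))^2\<close> have partial sums at most 1 by the odd bound, so the tail term tends
  to 0. Nonnegativity of the refined term serves both the upper estimates and the lower ones for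
  sharpness.\<close>

lemma refined_majorant_bound:
  assumes ser: "has_power_series_on_disc f a" and f: "f ` ball 0 1 \<subseteq> ball 0 1"
    and r: "0 \<le> r" "r < 1"
  shows "(\<Sum>n. norm (a (Suc n)) * r ^ Suc n) + refined_term a r \<le> (1 - (norm (a 0))\<^sup>2) * (r / (1 - r))"
    and "0 \<le> refined_term a r"
proof -
  note s1 = summable_norm_coeffs[OF ser r]
  define A where "A n = norm (a n)" for n
  have odd: "A (2 * n + 1) + (\<Sum>k\<le>n. (A k)\<^sup>2) \<le> 1" for n
    unfolding A_def using ser f by (rule coeff_odd_bound)
  have even: "A (2 * n) + (\<Sum>k<n. (A k)\<^sup>2) + (A n)\<^sup>2 / (1 + A 0) \<le> 1" if "n \<ge> 1" for n
    unfolding A_def using ser f that by (rule coeff_even_bound)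
  have A0: "A n \<ge> 0" for n by (simp add: A_def)
  have Q: "(\<Sum>k<K. (A (Suc k))\<^sup>2) \<le> 1" for K
  proof -
    have "(\<Sum>k\<le>K. (A k)\<^sup>2) = (A 0)\<^sup>2 + (\<Sum>k<K. (A (Suc k))\<^sup>2)"
      by (simp add: sum.lessThan_Suc_shift flip: lessThan_Suc_atMost del: sum.lessThan_Suc)
    then show ?thesis
      using odd[of K] A0[of "2 * K + 1"] zero_le_power2[of "A 0"] by linarith
  qed
  have s1': "summable (\<lambda>n. A (Suc n) * r ^ Suc n)"
    using s1 unfolding A_def by (subst summable_Suc_iff)
  have r2: "r ^ (2 * Suc k) \<le> 1" for k using r by (intro power_le_one) auto
  have s2: "summable (\<lambda>k. (A (Suc k))\<^sup>2 * r ^ (2 * Suc k))"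
  proof (rule summableI_nonneg_bounded[where x = 1])
    show "(\<Sum>k<K. (A (Suc k))\<^sup>2 * r ^ (2 * Suc k)) \<le> 1" for K
    proof -
      have "(\<Sum>k<K. (A (Suc k))\<^sup>2 * r ^ (2 * Suc k)) \<le> (\<Sum>k<K. (A (Suc k))\<^sup>2)"
        using r2 by (intro sum_mono mult_left_le) auto
      then show ?thesis using Q[of K] by linarith
    qed
  qed (use r in auto)
  have c0: "0 \<le> 1 / (1 + A 0) + r / (1 - r)" using r A0[of 0] by simp
  have "0 \<le> (\<Sum>k. (A (Suc k))\<^sup>2 * r ^ (2 * Suc k))"
    using r by (intro suminf_nonneg s2) auto
  with c0 show "0 \<le> refined_term a r"
    unfolding refined_term_def A_def by (rule mult_nonneg_nonneg)
  let ?c = "1 / (1 + A 0) + r / (1 - r)"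
  let ?L = "\<lambda>K. (\<Sum>n<2 * K. A (Suc n) * r ^ Suc n) + ?c * (\<Sum>k<K. (A (Suc k))\<^sup>2 * r ^ (2 * Suc k))"
  let ?R = "\<lambda>K. (1 - (A 0)\<^sup>2) * (\<Sum>n<2 * K. r ^ Suc n) + r ^ (2 * K + 1) / (1 - r)"
  have "?L K \<le> ?R K" for K
  proof -
    have "(\<Sum>k<K. (A (Suc k))\<^sup>2) * r ^ (2 * K + 1) / (1 - r) \<le> 1 * r ^ (2 * K + 1) / (1 - r)"
      using r Q[of K] by (intro divide_right_mono mult_right_mono) auto
    then show ?thesis
      using refined_majorant_partial_sum[OF odd even r, of K] by simp
  qed
  \<comment> \<open>The inequality is available only for partial sums of even length, so the limits
    are taken along subsequences.\<close>
  moreover have sub: "strict_mono (\<lambda>K::nat. 2 * K)" "strict_mono (\<lambda>K::nat. 2 * K + 1)"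
    by (auto simp: strict_mono_def)
  have lim1: "(\<lambda>K. \<Sum>n<2 * K. A (Suc n) * r ^ Suc n) \<longlonglongrightarrow> (\<Sum>n. A (Suc n) * r ^ Suc n)"
    using LIMSEQ_subseq_LIMSEQ[OF summable_LIMSEQ[OF s1'] sub(1)] by (simp add: o_def)
  have "(\<lambda>n. r * r ^ n) sums (r * (1 / (1 - r)))"
    using r by (intro sums_mult geometric_sums) auto
  then have "(\<lambda>K. \<Sum>n<K. r ^ Suc n) \<longlonglongrightarrow> r / (1 - r)"
    by (simp add: sums_def)
  from LIMSEQ_subseq_LIMSEQ[OF this sub(1)]
  have lim2: "(\<lambda>K. \<Sum>n<2 * K. r ^ Suc n) \<longlonglongrightarrow> r / (1 - r)" by (simp add: o_def)
  have "(\<lambda>n. r ^ n) \<longlonglongrightarrow> 0" using r by (intro LIMSEQ_power_zero) auto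
  from LIMSEQ_subseq_LIMSEQ[OF this sub(2)]
  have lim3: "(\<lambda>K. r ^ (2 * K + 1)) \<longlonglongrightarrow> 0" by (simp add: o_def)
  have "?L \<longlonglongrightarrow> (\<Sum>n. A (Suc n) * r ^ Suc n) + ?c * (\<Sum>k. (A (Suc k))\<^sup>2 * r ^ (2 * Suc k))"
    by (intro tendsto_add tendsto_mult tendsto_const lim1 summable_LIMSEQ s2)
  moreover have "?R \<longlonglongrightarrow> (1 - (A 0)\<^sup>2) * (r / (1 - r)) + 0 / (1 - r)"
    using r by (intro tendsto_add tendsto_mult tendsto_divide tendsto_const lim2 lim3) auto
  ultimately show "(\<Sum>n. norm (a (Suc n)) * r ^ Suc n) + refined_term a r
      \<le> (1 - (norm (a 0))\<^sup>2) * (r / (1 - r))"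
    using LIMSEQ_le[of ?L _ ?R] unfolding A_def refined_term_def by fastforce
qed

section \<open>Upper estimates for the two Bohr sums\<close>

lemma norm_diff_constant_coeff_le:
  assumes ser: "has_power_series_on_disc f a" and z: "z \<in> ball 0 1"
  shows "norm (f z - a 0) \<le> (\<Sum>n. norm (a (Suc n)) * norm z ^ Suc n)"
proof -
  have "(\<lambda>n. a n * z ^ n) sums f z" using ser z by (simp add: has_power_series_on_disc_def)
  then have "(\<lambda>n. a (Suc n) * z ^ Suc n) sums (f z - a 0)"
    by (subst sums_Suc_iff) simp
  then have "f z - a 0 = (\<Sum>n. a (Suc n) * z ^ Suc n)" by (rule sums_unique)
  moreover have "norm (\<Sum>n. a (Suc n) * z ^ Suc n) \<le> (\<Sum>n. norm (a (Suc n) * z ^ Suc n))"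
  proof (rule summable_norm)
    show "summable (\<lambda>n. norm (a (Suc n) * z ^ Suc n))"
      using summable_norm_coeffs[OF ser, of "norm z"] z
      by (subst summable_Suc_iff) (simp add: norm_mult norm_power)
  qed
  ultimately show ?thesis by (simp add: norm_mult norm_power)
qed

lemma bohr_sums_le:
  assumes ser: "has_power_series_on_disc f a" and f: "f ` ball 0 1 \<subseteq> ball 0 1" and z: "z \<in> ball 0 1"
  defines "x \<equiv> norm (a 0)" and "r \<equiv> norm z"
  shows "x < 1"
    and "bohr_sum1 f a z \<le> x + 2 * (1 - x\<^sup>2) * (r / (1 - r))"
    and "bohr_sum2 f a z \<le> x\<^sup>2 + 2 * (1 - x\<^sup>2) * (r / (1 - r))"
proof -
  have "a 0 = f 0" using ser by (force simp: has_power_series_on_disc_def dest: bspec[of _ _ 0])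
  moreover have "f 0 \<in> ball 0 1" using f by (rule subsetD) simp
  ultimately show "x < 1" by (simp add: x_def)
  have r: "0 \<le> r" "r < 1" using z by (auto simp: r_def)
  note S0 = summable_norm_coeffs[OF ser r]
  note R = refined_majorant_bound[OF ser f r]
  have D: "norm (f z - a 0) \<le> (\<Sum>n. norm (a (Suc n)) * r ^ Suc n)"
    unfolding r_def by (rule norm_diff_constant_coeff_le[OF ser z])
  have S: "(\<Sum>n. norm (a n) * r ^ n) = x + (\<Sum>n. norm (a (Suc n)) * r ^ Suc n)"
    using suminf_split_head[OF S0] by (simp add: x_def)
  \<comment> \<open>Write T for the sum over \<open>n \<ge> 1\<close> and E for the refined term. By
    \<open>D\<close> the quantity is at most \<open>x + 2 * T + E\<close>, and as E is nonnegative
    this is at most \<open>x + 2 * (T + E)\<close>, to which \<open>R\<close> applies.\<close>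
  show "bohr_sum1 f a z \<le> x + 2 * (1 - x\<^sup>2) * (r / (1 - r))"
    using S D R unfolding bohr_sum1_def r_def[symmetric] x_def by linarith
  show "bohr_sum2 f a z \<le> x\<^sup>2 + 2 * (1 - x\<^sup>2) * (r / (1 - r))"
    using D R unfolding bohr_sum2_def r_def[symmetric] x_def by linarith
qed

section \<open>Disc automorphisms and sharpness of the radii\<close>

text \<open>The witness is \<open>(x - z) / (1 - x * z)\<close>. Its coefficients after the constant
  one are all negative, so at the positive point \<open>r\<close> the triangle inequality for
  \<open>f r - a 0\<close> is an equality, and both sums are the same geometric series. The
  nonnegative refined term is dropped.\<close>

lemma bohr_sums_disc_automorphism:
  fixes x r :: real
  assumes x: "0 < x" "x < 1" and r: "0 < r" "r < 1"
  obtains f a where "f \<in> disc_self_maps" and "has_power_series_on_disc f a"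
    and "bohr_sum1 f a (of_real r) \<ge> x + 2 * (1 - x\<^sup>2) * (r / (1 - x * r))"
    and "bohr_sum2 f a (of_real r) \<ge> x\<^sup>2 + 2 * (1 - x\<^sup>2) * (r / (1 - x * r))"
proof -
  define f where "f z = - Moebius_function 0 (of_real x) z" for z
  define a where "a n = (case n of 0 \<Rightarrow> x | Suc n \<Rightarrow> - (1 - x\<^sup>2) * x ^ n)" for n
  have xz: "norm (of_real x * z) < 1" if "z \<in> ball 0 1" for z :: complex
  proof -
    have "x * norm z < 1 * 1" using x that by (intro mult_strict_mono') auto
    then show ?thesis using x by (simp add: norm_mult)
  qed
  have feq: "f z = x - (1 - x\<^sup>2) * z * (1 / (1 - x * z))" if "z \<in> ball 0 1" for z :: complex
  proof -
    have "1 - x * z \<noteq> 0" using xz[OF that] by auto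
    then show ?thesis
      by (simp add: f_def Moebius_function_def field_simps power2_eq_square)
  qed
  have maps: "f ` ball 0 1 \<subseteq> ball 0 1"
    using x by (auto simp: f_def intro!: Moebius_function_norm_lt_1)
  have "f holomorphic_on ball 0 1"
    unfolding f_def using x by (intro holomorphic_on_minus Moebius_function_holomorphic) auto
  then have "f \<in> disc_self_maps"
    using maps by (simp add: disc_self_maps_def analytic_on_open)
  moreover have ser: "has_power_series_on_disc f (\<lambda>n. of_real (a n))"
    unfolding has_power_series_on_disc_def
  proof
    fix z :: complex assume z: "z \<in> ball 0 1"
    have "(\<lambda>n. - (1 - x\<^sup>2) * z * (x * z) ^ n) sums (- (1 - x\<^sup>2) * z * (1 / (1 - x * z)))"
      by (intro sums_mult geometric_sums xz z)
    moreover have "f z - of_real (a 0) * z ^ 0 = - (1 - x\<^sup>2) * z * (1 / (1 - x * z))"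
      unfolding feq[OF z] a_def by (simp only: nat.case power_0 mult_1_right of_real_minus mult_minus_left) simp
    ultimately have "(\<lambda>n. of_real (a (Suc n)) * z ^ Suc n) sums (f z - of_real (a 0) * z ^ 0)"
      by (simp only: a_def nat.case) (simp add: power_mult_distrib mult_ac)
    then show "(\<lambda>n. of_real (a n) * z ^ n) sums f z"
      by (subst (asm) sums_Suc_iff) simp
  qed
  moreover have xr: "x * r < 1"
    using x r by (metis mult_strict_mono' less_imp_le mult_1)
  have x2: "x\<^sup>2 < 1" using x by (simp add: power_less_one_iff)
  have na: "norm (complex_of_real (a (Suc n))) * r ^ Suc n = (1 - x\<^sup>2) * r * (x * r) ^ n" for n
    unfolding norm_of_real using x x2 by (simp add: a_def power_mult_distrib abs_mult)
  have "(\<lambda>n. (1 - x\<^sup>2) * r * (x * r) ^ n) sums ((1 - x\<^sup>2) * r * (1 / (1 - x * r)))"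
    using x r xr by (intro sums_mult geometric_sums) (auto simp: abs_mult)
  then have S: "(\<Sum>n. norm (complex_of_real (a (Suc n))) * r ^ Suc n) = (1 - x\<^sup>2) * (r / (1 - x * r))"
    unfolding na by (simp add: sums_iff)
  note S0 = summable_norm_coeffs[OF ser less_imp_le[OF r(1)] r(2)]
  note R = refined_majorant_bound[OF ser maps less_imp_le[OF r(1)] r(2)]
  have S': "(\<Sum>n. norm (complex_of_real (a n)) * r ^ n) = x + (1 - x\<^sup>2) * (r / (1 - x * r))"
    using suminf_split_head[OF S0] S x by (simp add: a_def)
  have D: "norm (f (of_real r) - of_real (a 0)) = (1 - x\<^sup>2) * (r / (1 - x * r))"
  proof -
    have "f (of_real r) - of_real (a 0) = - of_real ((1 - x\<^sup>2) * (r / (1 - x * r)))"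
      using r by (subst feq) (auto simp: a_def)
    then have "norm (f (of_real r) - of_real (a 0)) = \<bar>(1 - x\<^sup>2) * (r / (1 - x * r))\<bar>"
      by (simp only: norm_minus_cancel norm_of_real)
    then show ?thesis using x2 xr r by simp
  qed
  have n: "norm (complex_of_real r) = r" "norm (complex_of_real (a 0)) = x"
    using r x by (auto simp: a_def)
  have "bohr_sum1 f (\<lambda>n. of_real (a n)) (of_real r) \<ge> x + 2 * (1 - x\<^sup>2) * (r / (1 - x * r))"
    using S' D R(2) unfolding bohr_sum1_def n by linarith
  moreover have "bohr_sum2 f (\<lambda>n. of_real (a n)) (of_real r) \<ge> x\<^sup>2 + 2 * (1 - x\<^sup>2) * (r / (1 - x * r))"
    using S D R(2) unfolding bohr_sum2_def n by linarith
  ultimately show ?thesis using that by blast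
qed

lemma bohr_sum1_radius_sharp:
  assumes R: "R > 1 / 5"
  shows "\<not> bohr_inequality_upto bohr_sum1 R"
proof
  assume B: "bohr_inequality_upto bohr_sum1 R"
  \<comment> \<open>The minimum keeps the point inside the disc even when \<open>R \<ge> 1\<close>,
    and it is still larger than \<open>1 / 5\<close>.\<close>
  define r where "r = min R (1 / 2)"
  have r: "1 / 5 < r" "r \<le> 1 / 2" "r \<le> R" using R by (auto simp: r_def)
  \<comment> \<open>After division by \<open>1 - x\<close>, exceeding 1 means
    \<open>1 - x * r < 2 * (1 + x) * r\<close>, that is \<open>x > (1 / r - 2) / 3\<close>. Such
    \<open>x < 1\<close> exist precisely because \<open>r > 1 / 5\<close>.\<close>
  have "max 0 ((1 / r - 2) / 3) < 1" using r by (simp add: field_simps)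
  then obtain x where x: "max 0 ((1 / r - 2) / 3) < x" "x < 1" using dense by blast
  then have x': "0 < x" "1 < r * (2 + 3 * x)" using r by simp_all (simp add: field_simps)
  obtain f a where f: "f \<in> disc_self_maps" "has_power_series_on_disc f a"
    and le: "bohr_sum1 f a (of_real r) \<ge> x + 2 * (1 - x\<^sup>2) * (r / (1 - x * r))"
    by (rule bohr_sums_disc_automorphism[of x r]) (use x x' r in auto)
  have "bohr_sum1 f a (of_real r) \<le> 1"
    using B f r by (auto simp: bohr_inequality_upto_def)
  moreover have "x + 2 * (1 - x\<^sup>2) * (r / (1 - x * r)) > 1"
  proof -
    have "x * r < 1 * 1" using x x' r by (intro mult_strict_mono) auto
    then have d: "1 - x * r > 0" by simp
    then have "1 < 2 * (1 + x) * (r / (1 - x * r))"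
      using x' by (simp add: field_simps)
    then have "(1 - x) * 1 < (1 - x) * (2 * (1 + x) * (r / (1 - x * r)))"
      using x by (intro mult_strict_left_mono) auto
    also have "\<dots> = 2 * (1 - x\<^sup>2) * (r / (1 - x * r))" by algebra
    finally show ?thesis by simp
  qed
  ultimately show False using le by linarith
qed

lemma bohr_sum2_radius_sharp:
  assumes R: "R > 1 / 3"
  shows "\<not> bohr_inequality_upto bohr_sum2 R"
proof
  assume B: "bohr_inequality_upto bohr_sum2 R"
  define r where "r = min R (1 / 2)"
  have r: "1 / 3 < r" "r \<le> 1 / 2" "r \<le> R" using R by (auto simp: r_def)
  \<comment> \<open>Here division by \<open>1 - x^2\<close> leaves the condition
    \<open>1 - x * r < 2 * r\<close>, that is \<open>x > 1 / r - 2\<close>, which is compatible with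
    \<open>x < 1\<close> because \<open>r > 1 / 3\<close>.\<close>
  have "max 0 (1 / r - 2) < 1" using r by (simp add: field_simps)
  then obtain x where x: "max 0 (1 / r - 2) < x" "x < 1" using dense by blast
  then have x': "0 < x" "1 < r * (2 + x)" using r by simp_all (simp add: field_simps)
  obtain f a where f: "f \<in> disc_self_maps" "has_power_series_on_disc f a"
    and le: "bohr_sum2 f a (of_real r) \<ge> x\<^sup>2 + 2 * (1 - x\<^sup>2) * (r / (1 - x * r))"
    by (rule bohr_sums_disc_automorphism[of x r]) (use x x' r in auto)
  have "bohr_sum2 f a (of_real r) \<le> 1"
    using B f r by (auto simp: bohr_inequality_upto_def)
  moreover have "x\<^sup>2 + 2 * (1 - x\<^sup>2) * (r / (1 - x * r)) > 1"
  proof -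
    have "x * r < 1 * 1" using x x' r by (intro mult_strict_mono) auto
    then have d: "1 - x * r > 0" by simp
    then have "1 < 2 * (r / (1 - x * r))"
      using x' by (simp add: field_simps)
    then have "(1 - x\<^sup>2) * 1 < (1 - x\<^sup>2) * (2 * (r / (1 - x * r)))"
      using x x' by (intro mult_strict_left_mono) (auto simp: power_less_one_iff)
    then show ?thesis by (simp add: mult_ac)
  qed
  ultimately show False using le by linarith
qed

section \<open>The inequalities up to the radii 1/5 and 1/3\<close>

lemma bohr_sum1_le_one: "bohr_inequality_upto bohr_sum1 (1/5)"
  unfolding bohr_inequality_upto_def
proof (intro ballI allI impI)
  fix f a and z :: complex assume "f \<in> disc_self_maps" and ser: "has_power_series_on_disc f a"
    and z: "z \<in> ball 0 1" "norm z \<le> 1 / 5"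
  then have f: "f ` ball 0 1 \<subseteq> ball 0 1" by (simp add: disc_self_maps_def)
  let ?x = "norm (a 0)" and ?q = "norm z / (1 - norm z)"
  note b = bohr_sums_le[OF ser f z(1)]
  have "?q \<le> 1 / 4" using z by (simp add: field_simps)
  then have "(1 - ?x\<^sup>2) * ?q \<le> (1 - ?x\<^sup>2) * (1 / 4)"
    using b(1) by (intro mult_left_mono) (auto simp: power_le_one_iff)
  \<comment> \<open>The estimate has become \<open>?x + (1 - ?x^2) / 2\<close>, which equals
    \<open>1 - (1 - ?x)^2 / 2\<close>.\<close>
  moreover have "2 * ?x \<le> 1 + ?x\<^sup>2" using sum_squares_bound[of 1 ?x] by simp
  ultimately have "?x + 2 * (1 - ?x\<^sup>2) * ?q \<le> 1" by argo
  then show "bohr_sum1 f a z \<le> 1" using b(2) by linarith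
qed

lemma bohr_sum2_le_one: "bohr_inequality_upto bohr_sum2 (1/3)"
  unfolding bohr_inequality_upto_def
proof (intro ballI allI impI)
  fix f a and z :: complex assume "f \<in> disc_self_maps" and ser: "has_power_series_on_disc f a"
    and z: "z \<in> ball 0 1" "norm z \<le> 1 / 3"
  then have f: "f ` ball 0 1 \<subseteq> ball 0 1" by (simp add: disc_self_maps_def)
  let ?x = "norm (a 0)" and ?q = "norm z / (1 - norm z)"
  note b = bohr_sums_le[OF ser f z(1)]
  \<comment> \<open>With this value the estimate collapses to \<open>?x^2 + (1 - ?x^2)\<close>,
    which is exactly 1.\<close>
  have "?q \<le> 1 / 2" using z by (simp add: field_simps)
  then have "(1 - ?x\<^sup>2) * ?q \<le> (1 - ?x\<^sup>2) * (1 / 2)"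
    using b(1) by (intro mult_left_mono) (auto simp: power_le_one_iff)
  then have "?x\<^sup>2 + 2 * (1 - ?x\<^sup>2) * ?q \<le> 1" by argo
  then show "bohr_sum2 f a z \<le> 1" using b(3) by linarith
qed

theorem theorem6:
  shows "bohr_inequality_upto bohr_sum1 (1/5)
       \<and> (\<forall>R>1/5. \<not> bohr_inequality_upto bohr_sum1 R)
       \<and> bohr_inequality_upto bohr_sum2 (1/3)
       \<and> (\<forall>R>1/3. \<not> bohr_inequality_upto bohr_sum2 R)"
  using bohr_sum1_le_one bohr_sum1_radius_sharp bohr_sum2_le_one bohr_sum2_radius_sharp by blast

end
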